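(* For every integer $n\geq 3$, \[|\mathrm{VPF}_n^{\uparrow}| = 2\,|\mathrm{VPF}_{n-1}^{\uparrow}| + |\mathrm{VPF}_{n-2}^{\uparrow}|,\] and $|\mathrm{VPF}_1^{\uparrow}|=1$, $|\mathrm{VPF}_2^{\uparrow}|=3$.
   Context: For $n\in\mathbb{N}$ let $[n]=\{1,\dots,n\}$. A preference list $\alpha=(a_1,\dots,a_n)\in[n]^n$ describes $n$ cars entering, in order $i=1,\dots,n$, a one-way street with spots $1,\dots,n$; car $i$ prefers spot $a_i$. Under the vacillating parking rule, car $i$ parks in spot $a_i$ if unoccupied; otherwise in spot $a_i-1$ if it exists and is unoccupied; otherwise in spot $a_i+1$ if it exists and is unoccupied; otherwise it fails to park. If all cars park, $\alpha$ is a vacillating parking function of length $n$. $\mathrm{VPF}_n^{\uparrow}$ denotes the set of vacillating parking functions $(a_1,\dots,a_n)$ of length $n$ with $a_1\leq a_2\leq\cdots\leq a_n$. *)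

theory Defs
  imports Main
begin

text \<open>Streets have spots \<open>1, \<dots>, n\<close>; \<open>S\<close> is the set of occupied spots and \<open>a\<close> the
  preferred spot of the arriving car. The result \<open>None\<close> means that the car fails to park.\<close>

definition vacillating_spot :: "nat \<Rightarrow> nat set \<Rightarrow> nat \<Rightarrow> nat option" where
  "vacillating_spot n S a =
    (if a \<notin> S then Some a
     else if 1 \<le> a - 1 \<and> a - 1 \<notin> S then Some (a - 1)
     else if a + 1 \<le> n \<and> a + 1 \<notin> S then Some (a + 1)
     else None)"

fun all_park :: "nat \<Rightarrow> nat set \<Rightarrow> nat list \<Rightarrow> bool" where
  "all_park n S [] = True"
| "all_park n S (a # as) =
    (case vacillating_spot n S a of
       None \<Rightarrow> False
     | Some s \<Rightarrow> all_park n (insert s S) as)"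

definition preference_lists :: "nat \<Rightarrow> nat list set" where
  "preference_lists n = {\<alpha>. length \<alpha> = n \<and> set \<alpha> \<subseteq> {1..n}}"

definition VPF :: "nat \<Rightarrow> nat list set" where
  "VPF n = {\<alpha> \<in> preference_lists n. all_park n {} \<alpha>}"

definition VPF_up :: "nat \<Rightarrow> nat list set" where
  "VPF_up n = {\<alpha> \<in> VPF n. sorted \<alpha>}"

end

theory Submission
  imports Defs
begin

text \<open>Feed a weakly increasing list to the street and suppose the occupied spots are
  \<open>{1..k}\<close>. The next car prefers \<open>k\<close> (only if \<open>k \<ge> 1\<close>) or \<open>k + 1\<close>, and parks in \<open>k + 1\<close>;
  or it prefers and takes \<open>k + 2\<close>, and then the next car must also prefer \<open>k + 2\<close>, since
  later preferences are too large to fill the hole \<open>k + 1\<close>. Every such choice is compatible with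
  monotonicity, so for \<open>k \<ge> 1\<close> the number of completions depends only on the number \<open>m\<close> of cars
  left and satisfies the Pell recurrence \<open>f (m + 2) = 2 * f (m + 1) + f m\<close>. At \<open>k = 0\<close> one
  choice is missing, which gives \<open>f (n - 1) + f (n - 2)\<close> lists for \<open>n \<ge> 2\<close>.\<close>

definition completions :: "nat \<Rightarrow> nat \<Rightarrow> nat list set" where
  "completions n k =
    {as. length as = n - k \<and> set as \<subseteq> {1..n} \<and> sorted as \<and> all_park n {1..k} as}"

text \<open>The Pell numbers 1, 2, 5, 12, ..., indexed so that the empty completion counts as
  \<open>pell 0 = 1\<close>.\<close>

fun pell :: "nat \<Rightarrow> nat" where
  "pell 0 = 1"
| "pell (Suc 0) = 2"
| "pell (Suc (Suc m)) = 2 * pell (Suc m) + pell m"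

lemma VPF_up_eq_completions: "VPF_up n = completions n 0"
  by (auto simp: VPF_up_def VPF_def preference_lists_def completions_def)

lemma finite_completions: "finite (completions n k)"
proof (rule finite_subset)
  show "completions n k \<subseteq> {as. set as \<subseteq> {1..n} \<and> length as = n - k}"
    by (auto simp: completions_def)
qed (simp add: finite_lists_length_eq)

lemma completions_full: "completions n n = {[]}"
  by (auto simp: completions_def)

lemma vacillating_spot_SomeD:
  assumes "vacillating_spot n S a = Some s" "a \<in> {1..n}"
  shows "s \<in> {1..n}" "s \<notin> S" "a \<le> s + 1"
  using assms by (auto simp: vacillating_spot_def split: if_splits)

text \<open>A car parks at most one spot below its preference, hence at \<open>h + 1\<close> or
  higher. So \<open>h\<close> stays empty and at most \<open>n - 1\<close> spots are ever
  taken.\<close>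

lemma hole_never_filled:
  assumes "all_park n S as" "S \<subseteq> {1..n} - {h}" "set as \<subseteq> {h + 2..n}" "h \<in> {1..n}"
  shows "length as + card S < n"
  using assms
proof (induction as arbitrary: S)
  case Nil
  have "card S \<le> card ({1..n} - {h})"
    by (rule card_mono) (use Nil in auto)
  then show ?case using Nil by auto
next
  case (Cons a as)
  then obtain s where s: "vacillating_spot n S a = Some s" "all_park n (insert s S) as"
    by (auto split: option.splits)
  have a: "a \<in> {1..n}" "a \<ge> h + 2" using Cons.prems by auto
  note sp = vacillating_spot_SomeD[OF s(1) a(1)]
  have "length as + card (insert s S) < n"
    by (rule Cons.IH) (use s sp a Cons.prems in auto)
  moreover have "finite S" using Cons.prems(2) finite_subset by blast
  ultimately show ?case using sp by simp
qed

text \<open>A first preference below \<open>k\<close> would find itself and its existing neighbours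
  occupied; sortedness passes the bound on. This is what keeps a list sorted when a choice at a
  smaller \<open>k\<close> is prepended.\<close>

lemma completions_ge:
  assumes "as \<in> completions n k" "x \<in> set as"
  shows "k \<le> x"
proof (cases as)
  case (Cons a bs)
  have "k \<le> a"
    using assms Cons
    by (auto simp: completions_def vacillating_spot_def split: if_splits)
  then show ?thesis using assms Cons by (auto simp: completions_def)
qed (use assms in auto)

lemma all_park_packed_Cons:
  assumes "k < n"
  shows "all_park n {1..k} (Suc k # as) = all_park n {1..Suc k} as"
    and "1 \<le> k \<Longrightarrow> all_park n {1..k} (k # as) = all_park n {1..Suc k} as"
  using assms by (auto simp: vacillating_spot_def atLeastAtMostSuc_conv)

text \<open>The first car takes \<open>k + 2\<close>; the second, finding it occupied, backs into
  \<open>k + 1\<close>.\<close>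

lemma all_park_packed_hole:
  assumes "k + 2 \<le> n"
  shows "all_park n {1..k} ((k + 2) # (k + 2) # as) = all_park n {1..k + 2} as"
proof -
  have "insert (Suc k) (insert (Suc (Suc k)) {Suc 0..k}) = {Suc 0..Suc (Suc k)}" by auto
  then show ?thesis by (simp add: vacillating_spot_def)
qed

lemma completions_Cons_cases:
  assumes "a # as \<in> completions n k" "k < n"
  shows "a = k \<or> a = k + 1 \<or> (a = k + 2 \<and> (\<exists>bs. as = (k + 2) # bs))"
proof (rule ccontr)
  assume contra: "\<not> ?thesis"
  have len: "length as + (k + 1) = n" and set: "set as \<subseteq> {1..n}" "a \<in> {1..n}"
    and srt: "sorted as" "\<forall>x\<in>set as. a \<le> x" and park: "all_park n {1..k} (a # as)"
    using assms by (auto simp: completions_def)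
  have ge: "k + 2 \<le> a" using completions_ge[OF assms(1), of a] contra by auto
  then have "vacillating_spot n {1..k} a = Some a" by (simp add: vacillating_spot_def)
  with park have park': "all_park n (insert a {1..k}) as" by simp
  have "set as \<subseteq> {k + 3..n}"
  proof (cases as)
    case (Cons b bs)
    then have "k + 3 \<le> b" using contra ge srt by (cases "a = k + 2"; cases "b = k + 2") auto
    then show ?thesis using Cons srt set by fastforce
  qed simp
  \<comment> \<open>Spot \<open>k + 1\<close> is the hole. With \<open>k + 1\<close> cars parked and
    \<open>length as\<close> to come, the sum is exactly \<open>n\<close>, a contradiction.\<close>
  then have "length as + card (insert a {1..k}) < n"
    using park' set ge assms(2) by (intro hole_never_filled[where h = "k + 1"]) auto
  then show False using len ge by simp
qed

lemma completions_step:
  assumes "k < n"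
  shows "completions n k =
    (#) (k + 1) ` completions n (k + 1) \<union>
    (if 1 \<le> k then (#) k ` completions n (k + 1) else {}) \<union>
    (if k + 2 \<le> n then (\<lambda>as. (k + 2) # (k + 2) # as) ` completions n (k + 2) else {})"
    (is "_ = ?R")
proof
  show "completions n k \<subseteq> ?R"
  proof
    fix cs assume cs: "cs \<in> completions n k"
    with assms obtain a as where [simp]: "cs = a # as"
      by (cases cs) (auto simp: completions_def)
    from cs assms consider "a = k" "1 \<le> k" | "a = k + 1"
      | bs where "a = k + 2" "as = (k + 2) # bs" "k + 2 \<le> n"
      using completions_Cons_cases[of a as n k] by (auto simp: completions_def)
    then show "cs \<in> ?R"
    proof cases
      case 1
      then have "as \<in> completions n (k + 1)"
        using cs assms all_park_packed_Cons(2)[of k n as]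
        by (auto simp: completions_def simp del: all_park.simps)
      with 1 show ?thesis by auto
    next
      case 2
      then have "as \<in> completions n (k + 1)"
        using cs assms all_park_packed_Cons(1)[of k n as]
        by (auto simp: completions_def simp del: all_park.simps)
      with 2 show ?thesis by auto
    next
      case 3
      then have "bs \<in> completions n (k + 2)"
        using cs all_park_packed_hole[of k n bs]
        by (auto simp: completions_def simp del: all_park.simps)
      with 3 show ?thesis by auto
    qed
  qed
next
  have "(k + 1) # as \<in> completions n k" if "as \<in> completions n (k + 1)" for as
    using that assms completions_ge[OF that] all_park_packed_Cons(1)[of k n as]
    by (auto simp: completions_def simp del: all_park.simps)
  moreover have "k # as \<in> completions n k" if "as \<in> completions n (k + 1)" "1 \<le> k" for as
    using that assms completions_ge[OF that(1)] all_park_packed_Cons(2)[of k n as]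
    by (fastforce simp: completions_def simp del: all_park.simps)
  moreover have "(k + 2) # (k + 2) # as \<in> completions n k"
    if "as \<in> completions n (k + 2)" "k + 2 \<le> n" for as
    using that completions_ge[OF that(1)] all_park_packed_hole[of k n as]
    by (auto simp: completions_def simp del: all_park.simps)
  ultimately show "?R \<subseteq> completions n k" by auto
qed

lemma card_completions_step:
  assumes "k < n"
  shows "card (completions n k) =
    (if 1 \<le> k then 2 else 1) * card (completions n (k + 1)) +
    (if k + 2 \<le> n then card (completions n (k + 2)) else 0)"
proof -
  have *: "card ((#) a ` completions n j) = card (completions n j)" for a j
    by (rule card_image) simp
  have **: "card ((\<lambda>as. a # b # as) ` completions n j) = card (completions n j)" for a b j
    by (rule card_image) (simp add: inj_on_def)
  show ?thesis
    unfolding completions_step[OF assms]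
    \<comment> \<open>The three images are disjoint because their lists start with different
      entries.\<close>
    by (subst card_Un_disjoint; (subst card_Un_disjoint)?)
       (auto simp: finite_completions * **)
qed

lemma card_completions: "1 \<le> k \<Longrightarrow> card (completions (k + m) k) = pell m"
proof (induction m arbitrary: k rule: pell.induct)
  case 1
  then show ?case by (simp add: completions_full)
next
  case 2
  \<comment> \<open>With one car left, \<open>k + 2\<close> lies off the street, so only
    \<open>k\<close> and \<open>k + 1\<close> remain as choices.\<close>
  then show ?case using completions_full[of "Suc k"] by (simp add: card_completions_step)
next
  case (3 m)
  then show ?case
    using "3.IH"(1)[of "k + 1"] "3.IH"(2)[of "k + 2"]
    by (simp add: card_completions_step[of k])
qed

lemma card_VPF_up_1: "card (VPF_up 1) = 1"
  using completions_full[of 1]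
  by (simp add: VPF_up_eq_completions card_completions_step)

lemma card_VPF_up: "card (VPF_up (m + 2)) = pell (m + 1) + pell m"
  \<comment> \<open>A list starts with 1, leaving \<open>m + 1\<close> cars, or with 2, 2, leaving
    \<open>m\<close>.\<close>
  using card_completions[of 1 "m + 1"] card_completions[of 2 m]
  by (simp add: VPF_up_eq_completions card_completions_step[of 0] numeral_2_eq_2)

theorem theorem3p2:
  shows "(\<forall>n::nat. n \<ge> 3 \<longrightarrow>
            card (VPF_up n) = 2 * card (VPF_up (n - 1)) + card (VPF_up (n - 2)))
       \<and> card (VPF_up 1) = 1
       \<and> card (VPF_up 2) = 3"
proof (intro conjI allI impI)
  fix n :: nat
  assume "n \<ge> 3"
  then obtain k where n: "n = k + 3" by (metis add.commute le_Suc_ex)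
  show "card (VPF_up n) = 2 * card (VPF_up (n - 1)) + card (VPF_up (n - 2))"
  proof (cases k)
    \<comment> \<open>Here \<open>n - 2 = 1\<close>, a length outside the reach of
      \<open>card_VPF_up\<close>.\<close>
    case 0
    then show ?thesis
      using n card_VPF_up[of 0] card_VPF_up[of 1] card_VPF_up_1 by (simp add: eval_nat_numeral)
  next
    case (Suc m)
    then show ?thesis
      using n card_VPF_up[of m] card_VPF_up[of "m + 1"] card_VPF_up[of "m + 2"]
      by (simp add: eval_nat_numeral)
  qed
next
  show "card (VPF_up 1) = 1" by (rule card_VPF_up_1)
  show "card (VPF_up 2) = 3" using card_VPF_up[of 0] by (simp add: numeral_2_eq_2)
qed

end
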